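(* Fix arbitrarily an interaction potential $J$, i.e. $J(0)=\infty$ and $J(n)\in\mathbb{R}\cup\{\infty\}$ for $n\in\mathbb{N}$, and let $y_0=0$, $y_k=e^{-J(k)}$ for $k\ge1$. For arbitrary $L\in\mathbb{N}$ and $N\in\{0,\dots,L\}$ consider the canonical headway measure $\mu^{can}_{L,N}$ corresponding to $J$. Then its canonical partition function $Z^{can}_{L,N}$ satisfies $Z^{can}_{L,0}=1$ and, for $1\le N\le L$, $$Z^{can}_{L,N}=\frac{L}{N}\sum_{n_1=0}^\infty y_{n_1+1}\sum_{n_2=0}^\infty y_{n_2+1}\cdots\sum_{n_N=0}^\infty y_{n_N+1}\;\delta_{\sum_{i=1}^Nn_i,\,L-N}.$$ Moreover, for $1\le N\le L$, $$Z^{can}_{L,N}=\frac{L}{N}\,y_1^N\,\tilde Z^{can}_{N,L-N}(\{y\}),\qquad \tilde Z^{can}_{N,L-N}(\{y\})=\sum_{\mathbf{n}=(n_0,\dots,n_{N-1})\in\tilde\Omega^{can}_{N,L-N}}\ \prod_{i=0}^{N-1}\frac{y_{n_i+1}}{y_1},$$ where $\tilde Z^{can}_{N,L-N}(\{y\})$ is the canonical partition function of the zero range process with $L-N$ particles on the torus $\mathbb{T}_N$ and with departure rates given by $g_0=0$, $g_k=y_k/y_{k+1}=e^{J(k+1)-J(k)}$, $k=1,2,\dots$.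
   Context: $\mathbb{N}=\{1,2,\dots\}$, $\mathbb{N}_0=\{0,1,2,\dots\}$, $\mathbb{T}_L=\mathbb{Z}/L\mathbb{Z}$ with sites $0,\dots,L-1$. Configurations: $\boldsymbol\eta=(\eta_0,\dots,\eta_{L-1})\in\{0,1\}^L$, where $\eta_x=1$ means that site $x$ is occupied by a particle; $\Omega^{can}_{L,N}=\{\boldsymbol\eta\in\{0,1\}^L:\sum_x\eta_x=N\}$. The headway of a particle is the number of empty sites between it and the next particle to its right on the torus; if there is a single particle, its headway is $L-1$. Headway indicator: $h_{x,n}(\boldsymbol\eta)=1$ if $\eta_x=1$ and the headway of the particle at $x$ is $n$, and $0$ otherwise. Boltzmann weight: $\pi_L(\boldsymbol\eta)=\prod_{x=0}^{L-1}\prod_{n=0}^{L-1}y_{n+1}^{h_{x,n}(\boldsymbol\eta)}$ (with $e^{-\infty}=0$ and $0^0=1$). Canonical partition function: $Z^{can}_{L,N}=\sum_{\boldsymbol\eta\in\Omega^{can}_{L,N}}\pi_L(\boldsymbol\eta)$. Canonical headway measure: $\mu^{can}_{L,N}(\boldsymbol\eta)=\pi_L(\boldsymbol\eta)/Z^{can}_{L,N}$ for $\boldsymbol\eta\in\Omega^{can}_{L,N}$. $\tilde\Omega^{can}_{N,K}=\{(n_0,\dots,n_{N-1})\in\mathbb{N}_0^N:\sum_in_i=K\}$. The zero range process on $\mathbb{T}_N$ with departure rates $\{g_k\}$ is the process of particles without exclusion in which a particle leaves a site carrying $k$ particles at rate $g_k$; its canonical partition function for $K$ particles is $\sum_{\mathbf{n}\in\tilde\Omega^{can}_{N,K}}\prod_{i=0}^{N-1}\prod_{m=1}^{n_i}g_m^{-1}$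 (empty products equal $1$). $\delta$ is the Kronecker delta.
   Formalization: The formula with y_1^N and the zero range identification assume J(1)<∞; the latter also that J(k)=∞ implies J(k+1)=∞ for 1≤k≤L-N; g_k=e^{J(k+1)-J(k)} is claimed unless J(k)=J(k+1)=∞; otherwise the quotients or products are undefined. *)

theory Defs
  imports Complex_Main "HOL-Library.FuncSet" "HOL-Library.Extended_Nonnegative_Real"
begin

section \<open>Interaction potentials and weights\<close>

definition interaction_potential :: "(nat \<Rightarrow> ereal) \<Rightarrow> bool" where
  "interaction_potential J \<longleftrightarrow> J 0 = \<infinity> \<and> (\<forall>n\<ge>1. J n \<noteq> -\<infinity>)"

text \<open>The exponential on the extended reals, with values in \<open>[0, \<infinity>]\<close>.\<close>

fun exp_ereal :: "ereal \<Rightarrow> ennreal" where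
  "exp_ereal (ereal r) = ennreal (exp r)"
| "exp_ereal PInfty = \<infinity>"
| "exp_ereal MInfty = 0"

text \<open>The weights \<open>y\<^sub>k\<close>. For an interaction potential, \<open>-J k < \<infinity>\<close>, so \<open>enn2real\<close> loses nothing.\<close>

definition weight :: "(nat \<Rightarrow> ereal) \<Rightarrow> nat \<Rightarrow> real" where
  "weight J k = (if k = 0 then 0 else enn2real (exp_ereal (- J k)))"

section \<open>The canonical headway ensemble\<close>

text \<open>The sites of the torus are \<open>0, \<dots>, L - 1\<close>, with addition modulo \<open>L\<close>.\<close>

definition configs :: "nat \<Rightarrow> nat \<Rightarrow> (nat \<Rightarrow> nat) set" where
  "configs L N = {\<eta> \<in> {..<L} \<rightarrow>\<^sub>E {0, 1}. (\<Sum>x<L. \<eta> x) = N}"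

text \<open>For a particle at \<open>x\<close>, the next particle to its right sits at \<open>x + headway + 1\<close> modulo \<open>L\<close>.
  A single particle is its own successor after one full turn, which gives headway \<open>L - 1\<close>.\<close>

definition headway :: "nat \<Rightarrow> (nat \<Rightarrow> nat) \<Rightarrow> nat \<Rightarrow> nat" where
  "headway L \<eta> x = (LEAST n. \<eta> ((x + n + 1) mod L) = 1)"

definition headway_indicator :: "nat \<Rightarrow> (nat \<Rightarrow> nat) \<Rightarrow> nat \<Rightarrow> nat \<Rightarrow> nat" where
  "headway_indicator L \<eta> x n = (if \<eta> x = 1 \<and> headway L \<eta> x = n then 1 else 0)"

definition boltzmann :: "(nat \<Rightarrow> ereal) \<Rightarrow> nat \<Rightarrow> (nat \<Rightarrow> nat) \<Rightarrow> real" where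
  "boltzmann J L \<eta> = (\<Prod>x<L. \<Prod>n<L. weight J (n + 1) ^ headway_indicator L \<eta> x n)"

definition Z_can :: "(nat \<Rightarrow> ereal) \<Rightarrow> nat \<Rightarrow> nat \<Rightarrow> real" where
  "Z_can J L N = (\<Sum>\<eta>\<in>configs L N. boltzmann J L \<eta>)"

section \<open>Iterated series\<close>

text \<open>\<open>iterated_suminf N w F\<close> is
  \<open>\<Sum>n\<^sub>1. w n\<^sub>1 * (\<Sum>n\<^sub>2. w n\<^sub>2 * ( \<dots> (\<Sum>n\<^sub>N. w n\<^sub>N * F [n\<^sub>1, \<dots>, n\<^sub>N])))\<close>,
  each index ranging over \<open>0, 1, 2, \<dots>\<close>.\<close>

fun iterated_suminf :: "nat \<Rightarrow> (nat \<Rightarrow> real) \<Rightarrow> (nat list \<Rightarrow> real) \<Rightarrow> real" where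
  "iterated_suminf 0 w F = F []"
| "iterated_suminf (Suc N) w F = (\<Sum>n. w n * iterated_suminf N w (\<lambda>ns. F (n # ns)))"

section \<open>The zero range process\<close>

definition zrp_configs :: "nat \<Rightarrow> nat \<Rightarrow> (nat \<Rightarrow> nat) set" where
  "zrp_configs N K = {n \<in> {..<N} \<rightarrow>\<^sub>E UNIV. (\<Sum>i<N. n i) = K}"

text \<open>Rates are \<open>ennreal\<close>-valued because \<open>y\<^sub>k / y\<^sub>k\<^sub>+\<^sub>1 = \<infinity>\<close> when \<open>J k < J (k + 1) = \<infinity>\<close>. In
  \<open>ennreal\<close>, \<open>inverse \<infinity> = 0\<close>, \<open>inverse 0 = \<infinity>\<close>, \<open>0 / 0 = 0\<close> and \<open>0 * \<infinity> = 0\<close>.\<close>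

definition zrp_partition :: "(nat \<Rightarrow> ennreal) \<Rightarrow> nat \<Rightarrow> nat \<Rightarrow> ennreal" where
  "zrp_partition g N K = (\<Sum>n\<in>zrp_configs N K. \<Prod>i<N. \<Prod>m=1..n i. inverse (g m))"

definition zrp_rate :: "(nat \<Rightarrow> ereal) \<Rightarrow> nat \<Rightarrow> ennreal" where
  "zrp_rate J k = (if k = 0 then 0 else ennreal (weight J k) / ennreal (weight J (k + 1)))"

text \<open>The quotient is meaningful only if \<open>y\<^sub>1 > 0\<close>, that is, \<open>J 1 < \<infinity>\<close>.\<close>

definition Z_tilde :: "(nat \<Rightarrow> ereal) \<Rightarrow> nat \<Rightarrow> nat \<Rightarrow> real" where
  "Z_tilde J N K = (\<Sum>n\<in>zrp_configs N K. \<Prod>i<N. weight J (n i + 1) / weight J 1)"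

end

theory Submission
  imports Defs
begin

text \<open>Marking a particle turns \<open>Z\<close> into \<open>L / N\<close> times the sum over configurations with a particle
  at the origin, because the weight is invariant under rotations of the torus. Such a configuration
  is a set of cut points \<open>0 = p\<^sub>0 < p\<^sub>1 < \<dots> < p\<^sub>N = L\<close> whose headways are the gaps
  \<open>p\<^sub>i\<^sub>+\<^sub>1 - p\<^sub>i - 1\<close>; removing the last cut point gives the recursion that the iterated
  series and the zero range partition function satisfy as well.\<close>

section \<open>Iterated sums with a constraint on the total\<close>

lemma iterated_suminf_zero: "iterated_suminf N w (\<lambda>_. 0) = 0"
  by (induction N) auto

text \<open>The coefficient of \<open>z ^ K\<close> in the \<open>N\<close>-th power of the power
  series with coefficients \<open>w\<close>; the indicator is the Kronecker delta of the
  theorem.\<close>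

definition constrained_sum :: "(nat \<Rightarrow> real) \<Rightarrow> nat \<Rightarrow> nat \<Rightarrow> real" where
  "constrained_sum w N K = iterated_suminf N w (\<lambda>ns. if sum_list ns = K then 1 else 0)"

lemma constrained_sum_0: "constrained_sum w 0 K = (if K = 0 then 1 else 0)"
  by (simp add: constrained_sum_def)

text \<open>Fixing the first index \<open>n\<close> leaves the total \<open>K - n\<close> for the
  others. An index above \<open>K\<close> contributes zero, so the series collapses to a finite
  sum.\<close>

lemma constrained_sum_Suc:
  "constrained_sum w (Suc N) K = (\<Sum>n\<le>K. w n * constrained_sum w N (K - n))"
proof -
  let ?t = "\<lambda>n. w n * iterated_suminf N w (\<lambda>ns. if n + sum_list ns = K then 1 else 0)"
  have "constrained_sum w (Suc N) K = (\<Sum>n. ?t n)"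
    by (simp add: constrained_sum_def)
  also have "\<dots> = (\<Sum>n\<le>K. ?t n)"
    by (rule suminf_finite) (auto simp: iterated_suminf_zero)
  also have "\<dots> = (\<Sum>n\<le>K. w n * constrained_sum w N (K - n))"
  proof (rule sum.cong[OF refl])
    fix n assume "n \<in> {..K}"
    then have "(\<lambda>ns. if n + sum_list ns = K then 1 else (0::real))
        = (\<lambda>ns. if sum_list ns = K - n then 1 else 0)"
      by (auto simp: fun_eq_iff)
    then show "?t n = w n * constrained_sum w N (K - n)"
      by (simp add: constrained_sum_def)
  qed
  finally show ?thesis .
qed

section \<open>Cut sets\<close>

definition gap :: "nat set \<Rightarrow> nat \<Rightarrow> nat" where
  "gap A x = (LEAST n. x + n + 1 \<in> A)"

text \<open>The torus is cut open at site 0, and \<open>L\<close> is a second copy of that site;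
  hence \<open>N\<close> particles give \<open>N + 1\<close> points.\<close>

definition cut_sets :: "nat \<Rightarrow> nat \<Rightarrow> nat set set" where
  "cut_sets L N = {A. A \<subseteq> {..L} \<and> 0 \<in> A \<and> L \<in> A \<and> card A = Suc N}"

text \<open>\<open>L\<close> is left out of the product: nothing lies to its right, and as a copy of
  the origin it has no gap of its own.\<close>

definition cut_sum :: "(nat \<Rightarrow> real) \<Rightarrow> nat \<Rightarrow> nat \<Rightarrow> real" where
  "cut_sum w L N = (\<Sum>A\<in>cut_sets L N. \<Prod>x\<in>A - {L}. w (gap A x))"

lemma finite_cut_sets: "finite (cut_sets L N)"
  by (rule finite_subset[of _ "Pow {..L}"]) (auto simp: cut_sets_def)

lemma cut_sets_0: "cut_sets L 0 = (if L = 0 then {{0}} else {})"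
  by (auto simp: cut_sets_def card_Suc_eq)

text \<open>Here \<open>m\<close> is the largest point below \<open>L\<close>: deleting
  \<open>L\<close> from a cut set leaves a cut set of the shorter segment that ends at
  \<open>m\<close>.\<close>

lemma cut_sets_Suc: "cut_sets L (Suc N) = (\<Union>m<L. insert L ` cut_sets m N)"
proof (intro equalityI subsetI)
  fix A assume A: "A \<in> cut_sets L (Suc N)"
  define B where "B = A - {L}"
  have fin: "finite A" using A by (auto simp: cut_sets_def intro: finite_subset)
  have cB: "card B = Suc N" using A fin by (simp add: B_def cut_sets_def)
  then have ne: "B \<noteq> {}" and fB: "finite B" by (auto intro: card_ge_0_finite)
  have "L \<noteq> 0"
    using A ne by (auto simp: cut_sets_def B_def)
  then have "0 \<in> B" using A by (auto simp: B_def cut_sets_def)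
  have m: "Max B \<in> B" using ne fB by simp
  then have "Max B < L" using A by (fastforce simp: B_def cut_sets_def)
  moreover have "B \<in> cut_sets (Max B) N"
    using m fB cB \<open>0 \<in> B\<close> by (auto simp: cut_sets_def)
  moreover have "A = insert L B" using A by (auto simp: B_def cut_sets_def)
  ultimately show "A \<in> (\<Union>m<L. insert L ` cut_sets m N)" by blast
next
  fix A assume "A \<in> (\<Union>m<L. insert L ` cut_sets m N)"
  then obtain m B where "m < L" and B: "B \<in> cut_sets m N" and A: "A = insert L B" by blast
  have "finite B" "L \<notin> B" using B \<open>m < L\<close> by (auto simp: cut_sets_def intro: finite_subset)
  then show "A \<in> cut_sets L (Suc N)" using B \<open>m < L\<close> by (auto simp: A cut_sets_def)
qed

text \<open>To the right of any \<open>x\<close> below \<open>m\<close> the set \<open>B\<close>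
  already has the point \<open>m\<close>, which is nearer than \<open>L\<close>.\<close>

lemma gap_insert_top:
  assumes "m < L" "B \<in> cut_sets m N" "x \<in> B - {m}"
  shows "gap (insert L B) x = gap B x"
proof -
  have xm: "x < m" and mB: "m \<in> B" and BL: "B \<subseteq> {..m}"
    using assms by (auto simp: cut_sets_def order.strict_iff_order)
  have ex: "x + (m - x - 1) + 1 \<in> B" using xm mB by simp
  have "x + gap B x + 1 \<in> B"
    unfolding gap_def using ex by (rule LeastI)
  then show ?thesis
    unfolding gap_def[of "insert L B"]
  proof (intro Least_equality)
    fix n assume n: "x + n + 1 \<in> insert L B"
    show "gap B x \<le> n"
    proof (cases "x + n + 1 \<in> B")
      case True
      then show ?thesis unfolding gap_def by (rule Least_le)
    next
      case False
      have "gap B x \<le> m - x - 1" unfolding gap_def using ex by (rule Least_le)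
      with False n \<open>m < L\<close> show ?thesis by auto
    qed
  qed simp
qed

lemma gap_last:
  assumes "m < L" "B \<in> cut_sets m N"
  shows "gap (insert L B) m = L - 1 - m"
  unfolding gap_def using assms by (intro Least_equality) (auto simp: cut_sets_def)

lemma cut_sum_0: "cut_sum w L 0 = (if L = 0 then 1 else 0)"
  by (simp add: cut_sum_def cut_sets_0)

text \<open>Cut sets are classified by their last point \<open>m\<close> before \<open>L\<close>.
  The last gap is \<open>L - 1 - m\<close>, and the other gaps are those of the cut set left after
  deleting \<open>L\<close>.\<close>

lemma cut_sum_Suc: "cut_sum w L (Suc N) = (\<Sum>m<L. w (L - 1 - m) * cut_sum w m N)"
proof -
  let ?f = "\<lambda>A. \<Prod>x\<in>A - {L}. w (gap A x)"
  have notin: "L \<notin> B" if "m < L" "B \<in> cut_sets m N" for m B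
    using that by (auto simp: cut_sets_def)
  have disj: "insert L ` cut_sets m N \<inter> insert L ` cut_sets m' N = {}"
    if "m < L" "m' < L" "m \<noteq> m'" for m m'
  proof -
    have False if "B \<in> cut_sets m N" "B' \<in> cut_sets m' N" "insert L B = insert L B'" for B B'
    proof -
      have "B = B'"
        using that notin \<open>m < L\<close> \<open>m' < L\<close> by (metis insert_ident)
      \<comment> \<open>The common set contains both \<open>m\<close> and \<open>m'\<close> and is
        bounded by each of them.\<close>
      with that have "m \<le> m'" "m' \<le> m" by (auto simp: cut_sets_def)
      with \<open>m \<noteq> m'\<close> show False by simp
    qed
    then show ?thesis by blast
  qed
  have "cut_sum w L (Suc N) = (\<Sum>m<L. \<Sum>A\<in>insert L ` cut_sets m N. ?f A)"
    unfolding cut_sum_def cut_sets_Suc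
    by (rule sum.UNION_disjoint) (use disj in \<open>auto simp: finite_cut_sets\<close>)
  also have "\<dots> = (\<Sum>m<L. w (L - 1 - m) * cut_sum w m N)"
  proof (rule sum.cong[OF refl])
    fix m assume "m \<in> {..<L}"
    then have m: "m < L" by simp
    have inj: "inj_on (insert L) (cut_sets m N)"
      by (rule inj_onI) (metis insert_ident notin m)
    have "?f (insert L B) = w (L - 1 - m) * (\<Prod>x\<in>B - {m}. w (gap B x))"
      if B: "B \<in> cut_sets m N" for B
    proof -
      have fB: "finite B" and mB: "m \<in> B"
        using B by (auto simp: cut_sets_def intro: finite_subset)
      have "?f (insert L B) = (\<Prod>x\<in>B. w (gap (insert L B) x))"
        using notin[OF m B] by simp
      also have "\<dots> = w (gap (insert L B) m) * (\<Prod>x\<in>B - {m}. w (gap (insert L B) x))"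
        using fB mB by (rule prod.remove)
      also have "(\<Prod>x\<in>B - {m}. w (gap (insert L B) x)) = (\<Prod>x\<in>B - {m}. w (gap B x))"
        by (rule prod.cong[OF refl]) (simp only: gap_insert_top[OF m B])
      finally show ?thesis by (simp only: gap_last[OF m B])
    qed
    then show "(\<Sum>A\<in>insert L ` cut_sets m N. ?f A) = w (L - 1 - m) * cut_sum w m N"
      by (simp add: sum.reindex[OF inj] cut_sum_def sum_distrib_left)
  qed
  finally show ?thesis .
qed

lemma cut_sum_eq_0:
  assumes "L < N"
  shows "cut_sum w L N = 0"
proof -
  have "A \<notin> cut_sets L N" for A
    using assms card_mono[of "{..L}" A] by (auto simp: cut_sets_def)
  then have "cut_sets L N = {}" by blast
  then show ?thesis by (simp add: cut_sum_def)
qed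

text \<open>Both sides satisfy the same recursion in \<open>N\<close>, the one removing the last gap
  and the other the first index; \<open>L - N\<close> is the total of all gaps.\<close>

lemma cut_sum_eq_constrained_sum:
  "N \<le> L \<Longrightarrow> cut_sum w L N = constrained_sum w N (L - N)"
proof (induction N arbitrary: L)
  case 0
  then show ?case by (simp add: cut_sum_0 constrained_sum_0)
next
  case (Suc N)
  have "cut_sum w L (Suc N) = (\<Sum>m<L. w (L - 1 - m) * cut_sum w m N)"
    by (rule cut_sum_Suc)
  \<comment> \<open>Substituting \<open>n = L - 1 - m\<close> makes the last gap the summation
    index.\<close>
  also have "\<dots> = (\<Sum>n<L. w n * cut_sum w (L - 1 - n) N)"
    by (rule sum.reindex_bij_witness[of _ "\<lambda>n. L - 1 - n" "\<lambda>n. L - 1 - n"]) auto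
  \<comment> \<open>For \<open>n > L - Suc N\<close> the remaining segment has length
    \<open>L - 1 - n < N\<close>, too short for \<open>N + 1\<close> cut points.\<close>
  also have "\<dots> = (\<Sum>n\<le>L - Suc N. w n * cut_sum w (L - 1 - n) N)"
    using Suc.prems by (intro sum.mono_neutral_right) (auto simp: cut_sum_eq_0)
  also have "\<dots> = (\<Sum>n\<le>L - Suc N. w n * constrained_sum w N (L - Suc N - n))"
    using Suc.prems by (intro sum.cong refl) (auto simp: Suc.IH intro!: arg_cong[where f="constrained_sum w N"])
  finally show ?case by (simp add: constrained_sum_Suc)
qed

section \<open>Configurations on the torus\<close>

lemma finite_configs: "finite (configs L N)"
  by (rule finite_subset[of _ "{..<L} \<rightarrow>\<^sub>E {0, 1}"]) (auto simp: configs_def intro!: finite_PiE)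

lemma card_occupied:
  assumes "\<eta> \<in> configs L N"
  shows "card {x\<in>{..<L}. \<eta> x = 1} = N"
proof -
  have "card {x\<in>{..<L}. \<eta> x = 1} = (\<Sum>x<L. if \<eta> x = 1 then 1 else 0)"
    by (simp add: sum.If_cases Int_def)
  also have "\<dots> = (\<Sum>x<L. \<eta> x)"
    using assms by (intro sum.cong) (auto simp: configs_def PiE_iff)
  finally show ?thesis using assms by (simp add: configs_def)
qed

text \<open>A full turn leads back to the particle itself, so the search stops at
  \<open>n = L - 1\<close> at the latest.\<close>

lemma headway_less:
  assumes "x < L" "\<eta> x = 1"
  shows "headway L \<eta> x < L"
proof -
  have "headway L \<eta> x \<le> L - 1"
    unfolding headway_def using assms by (intro Least_le) simp
  with assms show ?thesis by simp
qed

text \<open>At an occupied site exactly one exponent is 1, and its index, the headway, lies in the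
  range of the inner product by \<open>headway_less\<close>.\<close>

lemma boltzmann_eq_prod:
  "boltzmann J L \<eta> = (\<Prod>x<L. if \<eta> x = 1 then weight J (headway L \<eta> x + 1) else 1)"
  unfolding boltzmann_def
proof (rule prod.cong[OF refl])
  fix x assume "x \<in> {..<L}"
  have "(\<Prod>n<L. weight J (n + 1) ^ headway_indicator L \<eta> x n)
      = (\<Prod>n<L. if n = headway L \<eta> x then (if \<eta> x = 1 then weight J (n + 1) else 1) else 1)"
    by (rule prod.cong) (auto simp: headway_indicator_def)
  also have "\<dots> = (if \<eta> x = 1 then weight J (headway L \<eta> x + 1) else 1)"
    using \<open>x \<in> {..<L}\<close> headway_less[of x L \<eta>] by (auto simp: prod.delta)
  finally show "(\<Prod>n<L. weight J (n + 1) ^ headway_indicator L \<eta> x n)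
      = (if \<eta> x = 1 then weight J (headway L \<eta> x + 1) else 1)" .
qed

section \<open>Rotation invariance and the marked particle\<close>

text \<open>Site \<open>k\<close> becomes the origin. Restricting to \<open>{..<L}\<close> keeps the
  result extensional, as \<open>configs\<close> requires.\<close>

definition rotate_config :: "nat \<Rightarrow> nat \<Rightarrow> (nat \<Rightarrow> nat) \<Rightarrow> nat \<Rightarrow> nat" where
  "rotate_config L k \<eta> = (\<lambda>x\<in>{..<L}. \<eta> ((x + k) mod L))"

lemma rotate_config_apply: "x < L \<Longrightarrow> rotate_config L k \<eta> x = \<eta> ((x + k) mod L)"
  by (simp add: rotate_config_def)

text \<open>The inverse is the shift by \<open>L - k\<close>. The case \<open>k = L\<close> is
  included because it arises as the inverse rotation for \<open>k = 0\<close>.\<close>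

lemma bij_betw_shift_mod:
  assumes "k \<le> L"
  shows "bij_betw (\<lambda>x. (x + k) mod L) {..<L} {..<L::nat}"
proof (rule bij_betw_byWitness[where f' = "\<lambda>x. (x + (L - k)) mod L"])
  have "(a + k + (L - k)) mod L = a mod L" "(a + (L - k) + k) mod L = a mod L" for a
    using assms by (metis add.assoc le_add_diff_inverse mod_add_self2,
        metis add.assoc le_add_diff_inverse2 mod_add_self2)
  then show "\<forall>a\<in>{..<L}. ((a + k) mod L + (L - k)) mod L = a"
    "\<forall>a\<in>{..<L}. ((a + (L - k)) mod L + k) mod L = a"
    by (auto simp: mod_add_left_eq simp del: add_diff_assoc)
qed auto

lemma rotate_config_in_configs:
  assumes "k \<le> L" "\<eta> \<in> configs L N"
  shows "rotate_config L k \<eta> \<in> configs L N"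
proof -
  have "(\<Sum>x<L. rotate_config L k \<eta> x) = (\<Sum>x<L. \<eta> ((x + k) mod L))"
    by (intro sum.cong) (auto simp: rotate_config_apply)
  also have "\<dots> = (\<Sum>x<L. \<eta> x)"
    by (rule sum.reindex_bij_betw[OF bij_betw_shift_mod[OF assms(1)]])
  finally have "(\<Sum>x<L. rotate_config L k \<eta> x) = (\<Sum>x<L. \<eta> x)" .
  \<comment> \<open>The existence of a site \<open>x\<close> makes \<open>L\<close> positive, so
    that \<open>y mod L\<close> is a site.\<close>
  moreover have "\<eta> (y mod L) \<in> {0, 1}" if "x < L" for x y
    using assms(2) that by (auto simp: configs_def PiE_iff)
  ultimately show ?thesis
    using assms(2) unfolding configs_def by (auto simp: rotate_config_def PiE_iff)
qed

lemma headway_rotate_config: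
  assumes "x < L"
  shows "headway L (rotate_config L k \<eta>) x = headway L \<eta> ((x + k) mod L)"
proof -
  have "rotate_config L k \<eta> ((x + n + 1) mod L) = \<eta> (((x + k) mod L + n + 1) mod L)" for n
  proof -
    have "((x + n + 1) mod L + k) mod L = ((x + k) mod L + n + 1) mod L"
      by (metis (no_types, lifting) add.assoc add.commute mod_add_left_eq)
    then show ?thesis using assms by (simp add: rotate_config_apply)
  qed
  then show ?thesis by (simp add: headway_def)
qed

lemma boltzmann_rotate_config:
  assumes "k \<le> L"
  shows "boltzmann J L (rotate_config L k \<eta>) = boltzmann J L \<eta>"
proof -
  let ?f = "\<lambda>x. if \<eta> x = 1 then weight J (headway L \<eta> x + 1) else 1"
  have "boltzmann J L (rotate_config L k \<eta>) = (\<Prod>x<L. ?f ((x + k) mod L))"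
    unfolding boltzmann_eq_prod
    by (intro prod.cong) (auto simp: rotate_config_apply headway_rotate_config)
  also have "\<dots> = (\<Prod>x<L. ?f x)"
    by (rule prod.reindex_bij_betw[OF bij_betw_shift_mod[OF assms]])
  finally show ?thesis by (simp add: boltzmann_eq_prod)
qed

lemma rotate_config_inverse:
  assumes "\<eta> \<in> configs L N" "k + l = L"
  shows "rotate_config L k (rotate_config L l \<eta>) = \<eta>"
proof
  fix x
  show "rotate_config L k (rotate_config L l \<eta>) x = \<eta> x"
  proof (cases "x < L")
    case True
    have "((x + k) mod L + l) mod L = x"
      using True assms(2) by (simp add: mod_add_left_eq add.assoc)
    with True show ?thesis by (simp add: rotate_config_apply)
  next
    case False
    with assms(1) show ?thesis by (auto simp: rotate_config_def configs_def PiE_iff extensional_def)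
  qed
qed

text \<open>Rotation by \<open>k\<close> carries a particle at \<open>k\<close> to the origin; it is
  invertible on configurations and preserves the weight.\<close>

lemma sum_marked_particle:
  assumes "k < L"
  shows "(\<Sum>\<eta>\<in>{\<eta>\<in>configs L N. \<eta> k = 1}. boltzmann J L \<eta>)
       = (\<Sum>\<eta>\<in>{\<eta>\<in>configs L N. \<eta> 0 = 1}. boltzmann J L \<eta>)"
proof (rule sum.reindex_bij_witness[of _ "rotate_config L (L - k)" "rotate_config L k"])
  fix \<eta> assume "\<eta> \<in> {\<eta>\<in>configs L N. \<eta> k = 1}"
  with assms show "rotate_config L k \<eta> \<in> {\<eta>\<in>configs L N. \<eta> 0 = 1}"
    by (auto simp: rotate_config_in_configs rotate_config_apply)
next
  fix \<eta> assume "\<eta> \<in> {\<eta>\<in>configs L N. \<eta> 0 = 1}"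
  with assms show "rotate_config L (L - k) \<eta> \<in> {\<eta>\<in>configs L N. \<eta> k = 1}"
    by (auto simp: rotate_config_in_configs rotate_config_apply)
qed (use assms in \<open>auto simp: rotate_config_inverse boltzmann_rotate_config\<close>)

text \<open>Double counting of pairs of a configuration and an occupied site: each configuration has
  \<open>N\<close> such sites, while by rotation invariance each of the \<open>L\<close> sites
  contributes the same amount.\<close>

lemma Z_can_marked:
  "real N * Z_can J L N = real L * (\<Sum>\<eta>\<in>{\<eta>\<in>configs L N. \<eta> 0 = 1}. boltzmann J L \<eta>)"
proof -
  have "real N * Z_can J L N = (\<Sum>\<eta>\<in>configs L N. \<Sum>x<L. if \<eta> x = 1 then boltzmann J L \<eta> else 0)"
    unfolding Z_can_def sum_distrib_left
  proof (rule sum.cong[OF refl])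
    fix \<eta> assume "\<eta> \<in> configs L N"
    then show "real N * boltzmann J L \<eta> = (\<Sum>x<L. if \<eta> x = 1 then boltzmann J L \<eta> else 0)"
      using card_occupied[of \<eta> L N] by (simp add: sum.If_cases Int_def)
  qed
  also have "\<dots> = (\<Sum>x<L. \<Sum>\<eta>\<in>configs L N. if \<eta> x = 1 then boltzmann J L \<eta> else 0)"
    by (rule sum.swap)
  also have "\<dots> = (\<Sum>x<L. \<Sum>\<eta>\<in>{\<eta>\<in>configs L N. \<eta> x = 1}. boltzmann J L \<eta>)"
    by (simp add: sum.inter_filter finite_configs)
  also have "\<dots> = (\<Sum>x<L. \<Sum>\<eta>\<in>{\<eta>\<in>configs L N. \<eta> 0 = 1}. boltzmann J L \<eta>)"
    by (intro sum.cong refl sum_marked_particle) simp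
  finally show ?thesis by simp
qed

section \<open>Cutting the torus at an occupied origin\<close>

text \<open>An occupied origin stops the search for the next particle at \<open>L\<close> at the
  latest, so it never wraps beyond site 0.\<close>

lemma headway_eq_gap:
  assumes "x < L" "\<eta> 0 = 1"
  shows "headway L \<eta> x = gap (insert L {x\<in>{..<L}. \<eta> x = 1}) x"
proof -
  let ?A = "insert L {x\<in>{..<L}. \<eta> x = 1}"
  \<comment> \<open>Here \<open>x + n + 1\<close> is at most \<open>L\<close>; reduction modulo
    \<open>L\<close> acts only at \<open>L\<close> itself, where it gives the occupied
    origin.\<close>
  have iff: "\<eta> ((x + n + 1) mod L) = 1 \<longleftrightarrow> x + n + 1 \<in> ?A" if "n \<le> L - x - 1" for n
    using that assms by (cases "x + n + 1 = L") auto
  have top: "x + (L - x - 1) + 1 \<in> ?A" using assms by simp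
  have le: "gap ?A x \<le> L - x - 1"
    unfolding gap_def using top by (rule Least_le)
  show ?thesis
    unfolding headway_def
  proof (rule Least_equality)
    have "x + gap ?A x + 1 \<in> ?A" unfolding gap_def using top by (rule LeastI)
    then show "\<eta> ((x + gap ?A x + 1) mod L) = 1" using iff[OF le] by blast
  next
    fix n assume n: "\<eta> ((x + n + 1) mod L) = 1"
    show "gap ?A x \<le> n"
    proof (cases "n \<le> L - x - 1")
      case True
      then have "x + n + 1 \<in> ?A" using n iff by blast
      then show ?thesis unfolding gap_def by (rule Least_le)
    qed (use le in simp)
  qed
qed

text \<open>Adding \<open>L\<close> to the set of occupied sites is a bijection onto the cut sets,
  with indicator functions as inverse, and turns headways into gaps; \<open>L \<ge> 1\<close> keeps
  site 0 distinct from its copy \<open>L\<close>.\<close>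

lemma sum_origin_eq_cut_sum:
  assumes "L \<ge> 1"
  shows "(\<Sum>\<eta>\<in>{\<eta>\<in>configs L N. \<eta> 0 = 1}. boltzmann J L \<eta>)
       = cut_sum (\<lambda>n. weight J (n + 1)) L N"
  unfolding cut_sum_def
proof (rule sum.reindex_bij_witness[where
      i = "\<lambda>A. \<lambda>x\<in>{..<L}. if x \<in> A then 1 else 0"
      and j = "\<lambda>\<eta>. insert L {x\<in>{..<L}. \<eta> x = 1}"])
  fix \<eta> assume \<eta>: "\<eta> \<in> {\<eta>\<in>configs L N. \<eta> 0 = 1}"
  let ?S = "{x\<in>{..<L}. \<eta> x = 1}"
  show "(\<lambda>x\<in>{..<L}. if x \<in> insert L ?S then 1 else 0) = \<eta>"
    using \<eta> by (fastforce simp: fun_eq_iff configs_def PiE_iff extensional_def restrict_def)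
  show "insert L ?S \<in> cut_sets L N"
    using \<eta> assms card_occupied[of \<eta> L N] by (auto simp: cut_sets_def)
  have "boltzmann J L \<eta> = (\<Prod>x\<in>?S. weight J (headway L \<eta> x + 1))"
    unfolding boltzmann_eq_prod by (rule prod.inter_filter[symmetric]) simp
  also have "\<dots> = (\<Prod>x\<in>?S. weight J (gap (insert L ?S) x + 1))"
    using \<eta> by (intro prod.cong refl) (auto simp: headway_eq_gap)
  also have "?S = insert L ?S - {L}" by auto
  finally show "(\<Prod>x\<in>insert L ?S - {L}. weight J (gap (insert L ?S) x + 1)) = boltzmann J L \<eta>"
    by simp
next
  fix A assume A: "A \<in> cut_sets L N"
  let ?\<eta> = "\<lambda>x\<in>{..<L}. if x \<in> A then 1 else (0::nat)"
  have fin: "finite A" using A by (auto simp: cut_sets_def intro: finite_subset)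
  have eq: "{x\<in>{..<L}. ?\<eta> x = 1} = A - {L}"
    using A by (auto simp: cut_sets_def order.strict_iff_order split: if_splits)
  then show "insert L {x\<in>{..<L}. ?\<eta> x = 1} = A"
    using A by (auto simp: cut_sets_def)
  have "(\<Sum>x<L. ?\<eta> x) = card ({..<L} \<inter> A)"
    by (simp add: sum.If_cases)
  also have "{..<L} \<inter> A = A - {L}"
    using A by (auto simp: cut_sets_def order.strict_iff_order)
  also have "card (A - {L}) = N" using A fin by (simp add: cut_sets_def)
  finally show "?\<eta> \<in> {\<eta>\<in>configs L N. \<eta> 0 = 1}"
    using A assms by (auto simp: configs_def cut_sets_def)
qed

lemma Z_can_eq_constrained_sum:
  assumes "1 \<le> N" "N \<le> L"
  shows "Z_can J L N = real L / real N * constrained_sum (\<lambda>n. weight J (n + 1)) N (L - N)"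
  using assms Z_can_marked[of N J L] sum_origin_eq_cut_sum[of L J N]
  by (simp add: cut_sum_eq_constrained_sum field_simps)

lemma Z_can_0: "Z_can J L 0 = 1"
proof -
  have "configs L 0 = {\<lambda>x\<in>{..<L}. 0}"
    by (auto simp: configs_def fun_eq_iff PiE_iff extensional_def)
  then show ?thesis by (simp add: Z_can_def boltzmann_eq_prod)
qed

section \<open>The zero range process\<close>

lemma zrp_configs_le: "n \<in> zrp_configs N K \<Longrightarrow> i < N \<Longrightarrow> n i \<le> K"
  by (auto simp: zrp_configs_def intro: member_le_sum)

text \<open>The codomain in \<open>zrp_configs\<close> is infinite, but the total \<open>K\<close>
  bounds every entry.\<close>

lemma finite_zrp_configs: "finite (zrp_configs N K)"
proof (rule finite_subset)
  show "zrp_configs N K \<subseteq> {..<N} \<rightarrow>\<^sub>E {..K}"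
  proof
    fix n assume n: "n \<in> zrp_configs N K"
    then have "n \<in> extensional {..<N}" by (simp add: zrp_configs_def PiE_iff)
    with zrp_configs_le[OF n] show "n \<in> {..<N} \<rightarrow>\<^sub>E {..K}" by (simp add: PiE_iff)
  qed
qed (auto intro: finite_PiE)

text \<open>Splitting off the occupation number \<open>k\<close> of the last site yields the
  recursion \<open>constrained_sum_Suc\<close>.\<close>

lemma sum_zrp_configs_eq_constrained_sum:
  "(\<Sum>n\<in>zrp_configs N K. \<Prod>i<N. w (n i)) = constrained_sum w N K"
proof (induction N arbitrary: K)
  case 0
  have "zrp_configs 0 K = (if K = 0 then {\<lambda>_. undefined} else {})"
    by (auto simp: zrp_configs_def)
  then show ?case by (simp add: constrained_sum_0)
next
  case (Suc N)
  have "(\<Sum>n\<in>zrp_configs (Suc N) K. \<Prod>i<Suc N. w (n i))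
      = (\<Sum>(k, n)\<in>Sigma {..K} (\<lambda>k. zrp_configs N (K - k)). w k * (\<Prod>i<N. w (n i)))"
  \<comment> \<open>Resetting the value at \<open>N\<close> to \<open>undefined\<close> returns to
    the extensional functions on \<open>{..<N}\<close>.\<close>
  proof (rule sum.reindex_bij_witness[where
        i = "\<lambda>(k, n). n(N := k)" and j = "\<lambda>n. (n N, n(N := undefined))"])
    fix n assume n: "n \<in> zrp_configs (Suc N) K"
    then show "(case (n N, n(N := undefined)) of (k, n) \<Rightarrow> n(N := k)) = n" by simp
    show "(n N, n(N := undefined)) \<in> Sigma {..K} (\<lambda>k. zrp_configs N (K - k))"
      using n by (auto simp: zrp_configs_def PiE_iff extensional_def)
    show "(case (n N, n(N := undefined)) of (k, n) \<Rightarrow> w k * (\<Prod>i<N. w (n i)))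
        = (\<Prod>i<Suc N. w (n i))"
      by (simp add: mult.commute)
  next
    fix p assume "p \<in> Sigma {..K} (\<lambda>k. zrp_configs N (K - k))"
    then obtain k n where p: "p = (k, n)" "k \<le> K" "n \<in> zrp_configs N (K - k)" by auto
    have "n N = undefined" using p by (auto simp: zrp_configs_def PiE_iff extensional_def)
    then show "((case p of (k, n) \<Rightarrow> n(N := k)) N, (case p of (k, n) \<Rightarrow> n(N := k))(N := undefined)) = p"
      using p by (auto simp: fun_eq_iff)
    show "(case p of (k, n) \<Rightarrow> n(N := k)) \<in> zrp_configs (Suc N) K"
      using p by (auto simp: zrp_configs_def PiE_iff extensional_def)
  qed
  also have "\<dots> = (\<Sum>k\<le>K. w k * (\<Sum>n\<in>zrp_configs N (K - k). \<Prod>i<N. w (n i)))"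
    by (simp add: sum.Sigma[symmetric] finite_zrp_configs sum_distrib_left)
  finally show ?case by (simp add: Suc.IH constrained_sum_Suc)
qed

section \<open>Weights and departure rates\<close>

lemma exp_ereal_infinity: "exp_ereal \<infinity> = \<infinity>"
  using exp_ereal.simps(2) by simp

lemma exp_ereal_minus_infinity: "exp_ereal (- \<infinity>) = 0"
  using exp_ereal.simps(3) by simp

lemma weight_infinity: "J k = \<infinity> \<Longrightarrow> weight J k = 0"
  by (simp add: weight_def exp_ereal_minus_infinity)

lemma weight_ereal: "k \<ge> 1 \<Longrightarrow> J k = ereal r \<Longrightarrow> weight J k = exp (- r)"
  by (simp add: weight_def)

lemma weight_pos:
  assumes "interaction_potential J" "k \<ge> 1" "J k \<noteq> \<infinity>"
  shows "weight J k > 0"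
  using assms by (cases "J k") (auto simp: interaction_potential_def weight_ereal)

lemma weight_nonneg: "weight J k \<ge> 0"
  by (simp add: weight_def)

text \<open>One factor \<open>weight J 1\<close> is taken out for each of the \<open>N\<close>
  sites; it is positive because \<open>J 1\<close> is finite.\<close>

lemma constrained_sum_eq_Z_tilde:
  assumes "interaction_potential J" "J 1 \<noteq> \<infinity>"
  shows "constrained_sum (\<lambda>n. weight J (n + 1)) N K = weight J 1 ^ N * Z_tilde J N K"
  using weight_pos[OF assms(1) _ assms(2)]
  unfolding Z_tilde_def sum_zrp_configs_eq_constrained_sum[symmetric] sum_distrib_left
  by (simp add: prod_dividef)

text \<open>If only \<open>J k\<close> is infinite, both sides are 0; if only
  \<open>J (k + 1)\<close> is, both are \<infinity>; otherwise this is a quotient of exponentials.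
  The excluded case has 0 / 0 on the left and \<infinity> - \<infinity> on the right.\<close>

lemma zrp_rate_eq_exp:
  assumes "interaction_potential J" "k \<ge> 1" "\<not> (J k = \<infinity> \<and> J (k + 1) = \<infinity>)"
  shows "zrp_rate J k = exp_ereal (J (k + 1) - J k)"
proof (cases "J k")
  case (real r)
  show ?thesis
  proof (cases "J (k + 1)")
    case r': (real s)
    have "ennreal (exp (- r)) / ennreal (exp (- s)) = ennreal (exp (s - r))"
      by (simp add: divide_ennreal flip: exp_diff)
    then show ?thesis using assms(2) real r' by (simp add: zrp_rate_def weight_ereal)
  next
    case PInf
    then show ?thesis using assms(2) real
      by (simp add: zrp_rate_def weight_ereal weight_infinity exp_ereal_infinity)
  qed (use assms in \<open>auto simp: interaction_potential_def\<close>)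
next
  case PInf
  then obtain s where "J (k + 1) = ereal s"
    using assms by (cases "J (k + 1)") (auto simp: interaction_potential_def)
  then show ?thesis using assms(2) PInf
    by (simp add: zrp_rate_def weight_infinity exp_ereal_minus_infinity)
qed (use assms in \<open>auto simp: interaction_potential_def\<close>)

text \<open>Once a weight vanishes, so do all later ones, and the factors \<open>inverse (0 / 0) = \<infinity>\<close> are
  absorbed by an earlier factor \<open>inverse \<infinity> = 0\<close>.\<close>

lemma prod_inverse_zrp_rate:
  assumes "interaction_potential J" "J 1 \<noteq> \<infinity>"
    and "\<forall>k\<in>{1..n}. J k = \<infinity> \<longrightarrow> J (k + 1) = \<infinity>"
  shows "(\<Prod>m=1..n. inverse (zrp_rate J m)) = ennreal (weight J (n + 1) / weight J 1)"
  using assms(3)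
proof (induction n)
  case 0
  then show ?case using weight_pos[OF assms(1) _ assms(2)] by simp
next
  case (Suc n)
  have IH: "(\<Prod>m=1..n. inverse (zrp_rate J m)) = ennreal (weight J (n + 1) / weight J 1)"
    using Suc by simp
  have w1: "weight J 1 > 0" using weight_pos[OF assms(1) _ assms(2)] by simp
  have "(\<Prod>m=1..Suc n. inverse (zrp_rate J m))
      = ennreal (weight J (n + 1) / weight J 1) * inverse (zrp_rate J (n + 1))"
    using IH by simp
  also have "\<dots> = ennreal (weight J (Suc n + 1) / weight J 1)"
  proof (cases "J (n + 1) = \<infinity>")
    case True
    then have "J (Suc n + 1) = \<infinity>" using Suc.prems by simp
    \<comment> \<open>The product accumulated so far already vanishes, and it absorbs the new
      factor.\<close>
    with True show ?thesis by (simp add: weight_infinity)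
  next
    case False
    then have w: "weight J (n + 1) > 0" using weight_pos[OF assms(1)] by simp
    show ?thesis
    proof (cases "J (Suc n + 1) = \<infinity>")
      case True
      \<comment> \<open>The rate is a positive number over 0, hence \<infinity>; its inverse 0
        matches the vanishing new weight.\<close>
      then show ?thesis using w by (simp add: zrp_rate_def weight_infinity)
    next
      case False
      then have w': "weight J (Suc n + 1) > 0" using weight_pos[OF assms(1)] by simp
      \<comment> \<open>With both weights positive the product telescopes: the denominator of the
        inverse rate cancels the numerator reached so far.\<close>
      have "zrp_rate J (n + 1) = ennreal (weight J (n + 1) / weight J (Suc n + 1))"
        using w w' by (simp add: zrp_rate_def divide_ennreal)
      then have "inverse (zrp_rate J (n + 1)) = ennreal (weight J (Suc n + 1) / weight J (n + 1))"
        using w w' by (simp add: inverse_ennreal)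
      then show ?thesis using w w' w1 by (simp add: ennreal_mult[symmetric])
    qed
  qed
  finally show ?case .
qed

text \<open>Every occupation number is at most \<open>K\<close>, so the condition on
  \<open>J\<close> covers all rates that occur, and \<open>prod_inverse_zrp_rate\<close> applies
  site by site.\<close>

lemma Z_tilde_eq_zrp_partition:
  assumes "interaction_potential J" "J 1 \<noteq> \<infinity>"
    and "\<forall>k\<in>{1..K}. J k = \<infinity> \<longrightarrow> J (k + 1) = \<infinity>"
  shows "ennreal (Z_tilde J N K) = zrp_partition (zrp_rate J) N K"
proof -
  have nn: "weight J (n + 1) / weight J 1 \<ge> 0" for n
    by (simp add: weight_nonneg)
  have "ennreal (Z_tilde J N K)
      = (\<Sum>n\<in>zrp_configs N K. \<Prod>i<N. ennreal (weight J (n i + 1) / weight J 1))"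
    unfolding Z_tilde_def using nn
    by (simp add: sum_ennreal[symmetric] prod_ennreal prod_nonneg del: sum_ennreal)
  also have "\<dots> = zrp_partition (zrp_rate J) N K"
    unfolding zrp_partition_def
  proof (intro sum.cong prod.cong refl)
    fix n i assume "n \<in> zrp_configs N K" "i \<in> {..<N}"
    then have "n i \<le> K" by (simp add: zrp_configs_le)
    with assms show "ennreal (weight J (n i + 1) / weight J 1)
        = (\<Prod>m=1..n i. inverse (zrp_rate J m))"
      by (subst prod_inverse_zrp_rate) auto
  qed
  finally show ?thesis .
qed

theorem proposition3p8:
  fixes J :: "nat \<Rightarrow> ereal" and L :: nat
  assumes "interaction_potential J" and "L \<ge> 1"
  shows "Z_can J L 0 = 1
    \<and> (\<forall>N\<in>{1..L}. Z_can J L N = real L / real N *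
          iterated_suminf N (\<lambda>n. weight J (n + 1)) (\<lambda>ns. if sum_list ns = L - N then 1 else 0))
    \<and> (J 1 \<noteq> \<infinity> \<longrightarrow> (\<forall>N\<in>{1..L}. Z_can J L N = real L / real N * weight J 1 ^ N * Z_tilde J N (L - N)))
    \<and> (\<forall>N\<in>{1..L}. J 1 \<noteq> \<infinity> \<and> (\<forall>k\<in>{1..L - N}. J k = \<infinity> \<longrightarrow> J (k + 1) = \<infinity>)
          \<longrightarrow> ennreal (Z_tilde J N (L - N)) = zrp_partition (zrp_rate J) N (L - N))
    \<and> (\<forall>k\<ge>1. \<not> (J k = \<infinity> \<and> J (k + 1) = \<infinity>) \<longrightarrow>
          zrp_rate J k = exp_ereal (J (k + 1) - J k))"
proof (intro conjI ballI allI impI)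
  fix N assume "N \<in> {1..L}"
  then have N: "1 \<le> N" "N \<le> L" by auto
  show "Z_can J L N = real L / real N *
      iterated_suminf N (\<lambda>n. weight J (n + 1)) (\<lambda>ns. if sum_list ns = L - N then 1 else 0)"
    using Z_can_eq_constrained_sum[OF N] by (simp add: constrained_sum_def)
  show "Z_can J L N = real L / real N * weight J 1 ^ N * Z_tilde J N (L - N)" if "J 1 \<noteq> \<infinity>"
    using Z_can_eq_constrained_sum[OF N] constrained_sum_eq_Z_tilde[OF assms(1) that] by simp
next
  fix N assume "N \<in> {1..L}"
    and "J 1 \<noteq> \<infinity> \<and> (\<forall>k\<in>{1..L - N}. J k = \<infinity> \<longrightarrow> J (k + 1) = \<infinity>)"
  then show "ennreal (Z_tilde J N (L - N)) = zrp_partition (zrp_rate J) N (L - N)"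
    using Z_tilde_eq_zrp_partition[OF assms(1)] by blast
qed (rule Z_can_0, rule zrp_rate_eq_exp[OF assms(1)])

end
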